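(* The proof system ${\bf ECNZ^\Delta}$ is strongly complete with respect to the class of all $(cnz)$-frames, i.e. the class of all neighborhood frames possessing the properties $(c)$, $(n)$ and $(z)$.
   Context: Fix a nonempty set $\mathbf{P}$ of propositional variables. The language $\mathcal{L}(\Delta)$ is given by $\varphi::=p\in\mathbf{P}\mid\neg\varphi\mid\varphi\land\varphi\mid\Delta\varphi$; $\vee,\to,\leftrightarrow,\top$ are the usual abbreviations. A neighborhood frame is a pair $\langle S,N\rangle$ with $S$ a nonempty set and $N:S\to\mathcal{P}(\mathcal{P}(S))$; a neighborhood model $\mathcal{M}=\langle S,N,V\rangle$ adds a valuation $V$ assigning a set $V(p)\subseteq S$ to each $p\in\mathbf{P}$. Truth: $\mathcal{M},s\vDash p$ iff $s\in V(p)$; Boolean clauses as usual; $\mathcal{M},s\vDash\Delta\varphi$ iff $\varphi^{\mathcal{M}}\in N(s)$ or $S\setminus\varphi^{\mathcal{M}}\in N(s)$, where $\varphi^{\mathcal{M}}=\{s\in S\mid\mathcal{M},s\vDash\varphi\}$. Frame properties (required for every $s\in S$): $(c)$: $X,Y\in N(s)$ implies $X\cap Y\in N(s)$; $(n)$: $S\in N(s)$; $(z)$: $X\in N(s)$ implies $S\setminus X\in N(s)$. The system ${\bf ECNZ^\Delta}$ has as axiom schemas all instances of propositional tautologies (TAUT), $\Delta\text{Equ}$: $\Delta\varphi\leftrightarrow\Delta\neg\varphi$, $\Delta\text{C}$: $\Delta\varphi\land\Delta\psi\to\Delta(\varphi\land\psi)$, and $\Delta\text{N}$: $\Delta\top$;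 its rules are MP (from $\varphi$ and $\varphi\to\psi$ infer $\psi$) and $\text{RE}\Delta$ (from $\varphi\leftrightarrow\psi$ infer $\Delta\varphi\leftrightarrow\Delta\psi$). A set $\Gamma$ of formulas is consistent in a system $\Lambda$ if there are no $\gamma_1,\dots,\gamma_n\in\Gamma$ such that $\neg(\gamma_1\land\dots\land\gamma_n)$ is a theorem of $\Lambda$. $\Lambda$ is strongly complete with respect to a class $\mathbb{K}$ of frames if every $\Lambda$-consistent set of formulas is satisfied (all members true) at some state of some model based on a frame in $\mathbb{K}$. *)

theory Defs
  imports Main
begin

datatype 'p fm =
    Atom 'p
  | Neg "'p fm"  (\<open>\<^bold>\<not> _\<close> [70] 70)
  | Conj "'p fm" "'p fm"  (infixr \<open>\<^bold>\<and>\<close> 65)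
  | Delta "'p fm"  (\<open>\<Delta> _\<close> [70] 70)

abbreviation Disj :: "'p fm \<Rightarrow> 'p fm \<Rightarrow> 'p fm"  (infixr \<open>\<^bold>\<or>\<close> 60) where
  "\<phi> \<^bold>\<or> \<psi> \<equiv> \<^bold>\<not> (\<^bold>\<not> \<phi> \<^bold>\<and> \<^bold>\<not> \<psi>)"

abbreviation Imp :: "'p fm \<Rightarrow> 'p fm \<Rightarrow> 'p fm"  (infixr \<open>\<^bold>\<longrightarrow>\<close> 55) where
  "\<phi> \<^bold>\<longrightarrow> \<psi> \<equiv> \<^bold>\<not> \<phi> \<^bold>\<or> \<psi>"

abbreviation Iff :: "'p fm \<Rightarrow> 'p fm \<Rightarrow> 'p fm"  (infix \<open>\<^bold>\<longleftrightarrow>\<close> 50) where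
  "\<phi> \<^bold>\<longleftrightarrow> \<psi> \<equiv> (\<phi> \<^bold>\<longrightarrow> \<psi>) \<^bold>\<and> (\<psi> \<^bold>\<longrightarrow> \<phi>)"

text \<open>As types are nonempty, some propositional variable exists; \<open>\<top>\<close> is excluded middle for one
  arbitrary but fixed variable.\<close>

definition Top :: "'p fm"  (\<open>\<^bold>\<top>\<close>) where
  "\<^bold>\<top> = (let p = Atom (SOME p. True) in p \<^bold>\<or> \<^bold>\<not> p)"

text \<open>A frame is a pair of a carrier set and a neighborhood function, the latter relevant only on
  the carrier.\<close>

type_synonym 's frame = "'s set \<times> ('s \<Rightarrow> 's set set)"

definition nbhd_frame :: "'s frame \<Rightarrow> bool" where
  "nbhd_frame = (\<lambda>(S, N). S \<noteq> {} \<and> (\<forall>s\<in>S. N s \<subseteq> Pow S))"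

definition nbhd_model :: "'s frame \<Rightarrow> ('p \<Rightarrow> 's set) \<Rightarrow> bool" where
  "nbhd_model F V \<longleftrightarrow> nbhd_frame F \<and> (\<forall>p. V p \<subseteq> fst F)"

primrec sat :: "'s frame \<Rightarrow> ('p \<Rightarrow> 's set) \<Rightarrow> 's \<Rightarrow> 'p fm \<Rightarrow> bool" where
  "sat F V s (Atom p) \<longleftrightarrow> s \<in> V p"
| "sat F V s (\<^bold>\<not> \<phi>) \<longleftrightarrow> \<not> sat F V s \<phi>"
| "sat F V s (\<phi> \<^bold>\<and> \<psi>) \<longleftrightarrow> sat F V s \<phi> \<and> sat F V s \<psi>"
| "sat F V s (\<Delta> \<phi>) \<longleftrightarrow>
    {t \<in> fst F. sat F V t \<phi>} \<in> snd F s \<or> fst F - {t \<in> fst F. sat F V t \<phi>} \<in> snd F s"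

definition prop_c :: "'s frame \<Rightarrow> bool" where
  "prop_c = (\<lambda>(S, N). \<forall>s\<in>S. \<forall>X Y. X \<in> N s \<longrightarrow> Y \<in> N s \<longrightarrow> X \<inter> Y \<in> N s)"

definition prop_n :: "'s frame \<Rightarrow> bool" where
  "prop_n = (\<lambda>(S, N). \<forall>s\<in>S. S \<in> N s)"

definition prop_z :: "'s frame \<Rightarrow> bool" where
  "prop_z = (\<lambda>(S, N). \<forall>s\<in>S. \<forall>X. X \<in> N s \<longrightarrow> S - X \<in> N s)"

definition cnz_frames :: "'s frame set" where
  "cnz_frames = {F. nbhd_frame F \<and> prop_c F \<and> prop_n F \<and> prop_z F}"

text \<open>Propositional tautologies are formed over countably many schematic variables, independently
  of \<open>'p\<close>: if \<open>'p\<close> is finite, the tautologies over \<open>'p\<close> itself would not have enough instances.\<close>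

datatype pl = PVar nat | PNeg pl | PConj pl pl

primrec pl_eval :: "(nat \<Rightarrow> bool) \<Rightarrow> pl \<Rightarrow> bool" where
  "pl_eval v (PVar i) \<longleftrightarrow> v i"
| "pl_eval v (PNeg \<tau>) \<longleftrightarrow> \<not> pl_eval v \<tau>"
| "pl_eval v (PConj \<tau> \<tau>') \<longleftrightarrow> pl_eval v \<tau> \<and> pl_eval v \<tau>'"

definition pl_tautology :: "pl \<Rightarrow> bool" where
  "pl_tautology \<tau> \<longleftrightarrow> (\<forall>v. pl_eval v \<tau>)"

primrec pl_inst :: "(nat \<Rightarrow> 'p fm) \<Rightarrow> pl \<Rightarrow> 'p fm" where
  "pl_inst \<sigma> (PVar i) = \<sigma> i"
| "pl_inst \<sigma> (PNeg \<tau>) = \<^bold>\<not> pl_inst \<sigma> \<tau>"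
| "pl_inst \<sigma> (PConj \<tau> \<tau>') = pl_inst \<sigma> \<tau> \<^bold>\<and> pl_inst \<sigma> \<tau>'"

inductive ECNZ :: "'p fm \<Rightarrow> bool" where
  TAUT: "pl_tautology \<tau> \<Longrightarrow> ECNZ (pl_inst \<sigma> \<tau>)"
| Equ: "ECNZ (\<Delta> \<phi> \<^bold>\<longleftrightarrow> \<Delta> (\<^bold>\<not> \<phi>))"
| C: "ECNZ (\<Delta> \<phi> \<^bold>\<and> \<Delta> \<psi> \<^bold>\<longrightarrow> \<Delta> (\<phi> \<^bold>\<and> \<psi>))"
| N: "ECNZ (\<Delta> \<^bold>\<top>)"
| MP: "ECNZ \<phi> \<Longrightarrow> ECNZ (\<phi> \<^bold>\<longrightarrow> \<psi>) \<Longrightarrow> ECNZ \<psi>"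
| RE: "ECNZ (\<phi> \<^bold>\<longleftrightarrow> \<psi>) \<Longrightarrow> ECNZ (\<Delta> \<phi> \<^bold>\<longleftrightarrow> \<Delta> \<psi>)"

text \<open>A proof system enters through its set of theorems, given as a predicate. The list
  \<open>\<gamma> # \<gamma>s\<close> is the sequence \<open>\<gamma>\<^sub>1, \<dots>, \<gamma>\<^sub>n\<close> with \<open>n \<ge> 1\<close>.\<close>

definition consistent :: "('p fm \<Rightarrow> bool) \<Rightarrow> 'p fm set \<Rightarrow> bool" where
  "consistent \<Lambda> \<Gamma> \<longleftrightarrow> \<not> (\<exists>\<gamma> \<gamma>s. set (\<gamma> # \<gamma>s) \<subseteq> \<Gamma> \<and> \<Lambda> (\<^bold>\<not> foldl Conj \<gamma> \<gamma>s))"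

definition strongly_complete :: "('p fm \<Rightarrow> bool) \<Rightarrow> 's frame set \<Rightarrow> bool" where
  "strongly_complete \<Lambda> K \<longleftrightarrow>
    (\<forall>\<Gamma>. consistent \<Lambda> \<Gamma> \<longrightarrow>
      (\<exists>F\<in>K. \<exists>V. nbhd_model F V \<and> (\<exists>s\<in>fst F. \<forall>\<phi>\<in>\<Gamma>. sat F V s \<phi>)))"

text \<open>HOL cannot quantify existentially over the type of states. Completeness with respect to the
  frames over one particular type \<open>'s\<close> implies completeness with respect to all frames, since the
  satisfying model is only asked to exist; the type \<open>'p fm set\<close> has room for the maximal consistent
  sets.\<close>

end

theory Submission
  imports Defs
begin

text \<open>
  Strong completeness is proved by a canonical model. Its states are the maximal consistent sets,
  here in the form of the Boolean valuations that make every theorem true, and the neighborhoods of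
  a state \<open>s\<close> are the proof sets of those \<open>\<phi>\<close> with \<open>\<Delta> \<phi> \<in> s\<close>. The operator \<open>\<Delta>\<close> cannot tell \<open>\<phi>\<close>
  from \<open>\<^bold>\<not> \<phi>\<close>, which in general obstructs recovering a neighborhood function from it. On a frame
  with property \<open>(z)\<close>, however, a set is a neighborhood as soon as its complement is one, so that
  \<open>\<Delta> \<phi>\<close> just says that the truth set of \<open>\<phi>\<close> is a neighborhood, and \<open>\<Delta>\<close> behaves as the box
  of neighborhood semantics. The axioms \<open>\<Delta>Equ\<close>, \<open>\<Delta>C\<close> and \<open>\<Delta>N\<close> then yield the properties
  \<open>(z)\<close>, \<open>(c)\<close> and \<open>(n)\<close> of the canonical frame, one each.

  All of this rests on two facts about states. By \<open>ECNZ_state_extension\<close>, a nonempty consistent set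
  is contained in a state. By \<open>Delta_iff_proof_set\<close>, whether \<open>\<Delta> \<phi>\<close> belongs to a state depends
  only on the proof set of \<open>\<phi>\<close>: formulas with the same proof set are provably equivalent, and
  \<open>RE\<Delta>\<close> applies. Both reduce to the compactness theorem for propositional logic. The
  theorems of the system are closed under tautological consequence, so a family of premises together
  with all theorems is finitely satisfiable by valuations unless finitely many of the premises are
  refuted, and compactness then provides a valuation that satisfies everything at once.
\<close>

section \<open>Propositional compactness\<close>

text \<open>Atoms and formulas \<open>\<Delta> \<phi>\<close> alike are treated as propositional letters. A valuation is given as
  the set of formulas that it makes true, so that it can serve as a state of the canonical model.\<close>

definition valuation :: "'p fm set \<Rightarrow> bool" where
  "valuation v \<longleftrightarrow> (\<forall>\<phi>. \<^bold>\<not> \<phi> \<in> v \<longleftrightarrow> \<phi> \<notin> v) \<and> (\<forall>\<phi> \<psi>. \<phi> \<^bold>\<and> \<psi> \<in> v \<longleftrightarrow> \<phi> \<in> v \<and> \<psi> \<in> v)"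

lemma valuation_Neg [simp]: "valuation v \<Longrightarrow> \<^bold>\<not> \<phi> \<in> v \<longleftrightarrow> \<phi> \<notin> v"
  and valuation_Conj [simp]: "valuation v \<Longrightarrow> \<phi> \<^bold>\<and> \<psi> \<in> v \<longleftrightarrow> \<phi> \<in> v \<and> \<psi> \<in> v"
  by (simp_all add: valuation_def)

lemma valuation_Top [simp]: "valuation v \<Longrightarrow> \<^bold>\<top> \<in> v"
  by (simp add: Top_def Let_def)

lemma valuation_foldl_Conj [simp]:
  "valuation v \<Longrightarrow> foldl Conj \<gamma> \<gamma>s \<in> v \<longleftrightarrow> \<gamma> \<in> v \<and> set \<gamma>s \<subseteq> v"
  by (induction \<gamma>s arbitrary: \<gamma>) auto

definition finitely_satisfiable :: "'p fm set \<Rightarrow> bool" where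
  "finitely_satisfiable \<Gamma> \<longleftrightarrow> (\<forall>A\<subseteq>\<Gamma>. finite A \<longrightarrow> (\<exists>v. valuation v \<and> A \<subseteq> v))"

lemma finitely_satisfiable_insert:
  assumes "finitely_satisfiable M"
  shows "finitely_satisfiable (insert \<phi> M) \<or> finitely_satisfiable (insert (\<^bold>\<not> \<phi>) M)"
proof (rule ccontr)
  assume "\<not> ?thesis"
  then obtain A B where A: "A \<subseteq> insert \<phi> M" "finite A" "\<And>v. valuation v \<Longrightarrow> \<not> A \<subseteq> v"
    and B: "B \<subseteq> insert (\<^bold>\<not> \<phi>) M" "finite B" "\<And>v. valuation v \<Longrightarrow> \<not> B \<subseteq> v"
    unfolding finitely_satisfiable_def by blast
  have "(A - {\<phi>}) \<union> (B - {\<^bold>\<not> \<phi>}) \<subseteq> M" "finite ((A - {\<phi>}) \<union> (B - {\<^bold>\<not> \<phi>}))"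
    using A B by auto
  then obtain v where "valuation v" "(A - {\<phi>}) \<union> (B - {\<^bold>\<not> \<phi>}) \<subseteq> v"
    using assms unfolding finitely_satisfiable_def by meson
  then have "A \<subseteq> v \<or> B \<subseteq> v"
    by (cases "\<phi> \<in> v") auto
  then show False
    using A(3) B(3) \<open>valuation v\<close> by blast
qed

text \<open>A maximal finitely satisfiable set decides every formula, hence contains every consequence of
  any finite part of it, which makes it a valuation.\<close>

theorem propositional_compactness:
  assumes "finitely_satisfiable \<Gamma>"
  obtains v where "valuation v" "\<Gamma> \<subseteq> v"
proof -
  let ?E = "{X. \<Gamma> \<subseteq> X \<and> finitely_satisfiable X}"
  have "\<exists>M\<in>?E. \<forall>X\<in>?E. M \<subseteq> X \<longrightarrow> X = M"
  proof (rule subset_Zorn_nonempty)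
    show "?E \<noteq> {}"
      using assms by blast
    fix C assume C: "C \<noteq> {}" "subset.chain ?E C"
    then have E: "C \<subseteq> ?E"
      by (simp add: subset_chain_def)
    have "\<exists>v. valuation v \<and> A \<subseteq> v" if A: "A \<subseteq> \<Union>C" "finite A" for A
    proof -
      obtain X where "X \<in> C" "A \<subseteq> X"
        using finite_subset_Union_chain[OF A(2,1) C] .
      then show ?thesis
        using E A(2) unfolding finitely_satisfiable_def by blast
    qed
    then have "finitely_satisfiable (\<Union>C)"
      by (simp add: finitely_satisfiable_def)
    then show "\<Union>C \<in> ?E"
      using C(1) E by blast
  qed
  then obtain M where "M \<in> ?E" and M_max: "\<forall>X\<in>?E. M \<subseteq> X \<longrightarrow> X = M" ..
  then have M: "\<Gamma> \<subseteq> M" "finitely_satisfiable M"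
    by simp_all
  have maximal: "\<psi> \<in> M" if "finitely_satisfiable (insert \<psi> M)" for \<psi>
  proof -
    have "insert \<psi> M = M"
      using that M(1) by (intro M_max[rule_format]) auto
    then show ?thesis
      by blast
  qed
  have decided: "\<phi> \<in> M \<or> \<^bold>\<not> \<phi> \<in> M" for \<phi>
    using finitely_satisfiable_insert[OF M(2), of \<phi>] by (elim disj_forward maximal)
  have closed: "\<phi> \<in> M"
    if "A \<subseteq> M" "finite A" "\<And>v. valuation v \<Longrightarrow> A \<subseteq> v \<Longrightarrow> \<phi> \<in> v" for A \<phi>
  proof (rule ccontr)
    assume "\<phi> \<notin> M"
    then have "insert (\<^bold>\<not> \<phi>) A \<subseteq> M" "finite (insert (\<^bold>\<not> \<phi>) A)"
      using decided that by auto
    then obtain v where "valuation v" "insert (\<^bold>\<not> \<phi>) A \<subseteq> v"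
      using M(2) unfolding finitely_satisfiable_def by meson
    then show False
      using that(3) by auto
  qed
  have "\<not> (\<phi> \<in> M \<and> \<^bold>\<not> \<phi> \<in> M)" for \<phi>
  proof
    assume "\<phi> \<in> M \<and> \<^bold>\<not> \<phi> \<in> M"
    then have "{\<phi>, \<^bold>\<not> \<phi>} \<subseteq> M" "finite {\<phi>, \<^bold>\<not> \<phi>}"
      by auto
    then obtain v where "valuation v" "{\<phi>, \<^bold>\<not> \<phi>} \<subseteq> v"
      using M(2) unfolding finitely_satisfiable_def by meson
    then show False
      by auto
  qed
  then have "\<^bold>\<not> \<phi> \<in> M \<longleftrightarrow> \<phi> \<notin> M" for \<phi>
    using decided by blast
  moreover have "\<phi> \<^bold>\<and> \<psi> \<in> M \<longleftrightarrow> \<phi> \<in> M \<and> \<psi> \<in> M" for \<phi> \<psi>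
  proof (intro iffI conjI)
    show "\<phi> \<in> M" "\<psi> \<in> M" if "\<phi> \<^bold>\<and> \<psi> \<in> M"
      by (rule closed[of "{\<phi> \<^bold>\<and> \<psi>}"]; use that in simp)+
    show "\<phi> \<^bold>\<and> \<psi> \<in> M" if "\<phi> \<in> M \<and> \<psi> \<in> M"
      by (rule closed[of "{\<phi>, \<psi>}"]; use that in simp)
  qed
  ultimately have "valuation M"
    unfolding valuation_def by blast
  then show thesis
    using M(1) that by blast
qed

section \<open>Tautological consequence in the proof system\<close>

primrec letters :: "'p fm \<Rightarrow> 'p fm set" where
  "letters (Atom p) = {Atom p}"
| "letters (\<^bold>\<not> \<phi>) = letters \<phi>"
| "letters (\<phi> \<^bold>\<and> \<psi>) = letters \<phi> \<union> letters \<psi>"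
| "letters (\<Delta> \<phi>) = {\<Delta> \<phi>}"

primrec skeleton :: "('p fm \<Rightarrow> nat) \<Rightarrow> 'p fm \<Rightarrow> pl" where
  "skeleton f (Atom p) = PVar (f (Atom p))"
| "skeleton f (\<^bold>\<not> \<phi>) = PNeg (skeleton f \<phi>)"
| "skeleton f (\<phi> \<^bold>\<and> \<psi>) = PConj (skeleton f \<phi>) (skeleton f \<psi>)"
| "skeleton f (\<Delta> \<phi>) = PVar (f (\<Delta> \<phi>))"

lemma finite_letters: "finite (letters \<phi>)"
  by (induction \<phi>) auto

lemma pl_inst_skeleton:
  "(\<And>\<psi>. \<psi> \<in> letters \<phi> \<Longrightarrow> g (f \<psi>) = \<psi>) \<Longrightarrow> pl_inst g (skeleton f \<phi>) = \<phi>"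
  by (induction \<phi>) auto

lemma valuation_pl_eval: "valuation {\<phi>. pl_eval u (skeleton f \<phi>)}"
  by (simp add: valuation_def)

text \<open>The variables of \<open>'p\<close> need not be countable, but a single formula has only finitely many
  letters, which can be numbered injectively.\<close>

lemma ECNZ_valid:
  assumes "\<And>v. valuation v \<Longrightarrow> \<phi> \<in> v"
  shows "ECNZ \<phi>"
proof -
  obtain f :: "'a fm \<Rightarrow> nat" where f: "inj_on f (letters \<phi>)"
    using finite_imp_inj_to_nat_seg[OF finite_letters] by blast
  have "pl_tautology (skeleton f \<phi>)"
    using assms[OF valuation_pl_eval] by (simp add: pl_tautology_def)
  then have "ECNZ (pl_inst (inv_into (letters \<phi>) f) (skeleton f \<phi>))"
    by (rule ECNZ.TAUT)
  then show ?thesis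
    by (simp add: pl_inst_skeleton f)
qed

lemma ECNZ_consequence:
  assumes "finite T" "\<And>\<tau>. \<tau> \<in> T \<Longrightarrow> ECNZ \<tau>"
    and "\<And>v. valuation v \<Longrightarrow> T \<subseteq> v \<Longrightarrow> \<phi> \<in> v"
  shows "ECNZ \<phi>"
  using assms
proof (induction T arbitrary: \<phi> rule: finite_induct)
  case empty
  then show ?case
    using ECNZ_valid by blast
next
  case (insert \<tau> T)
  have "ECNZ (\<tau> \<^bold>\<longrightarrow> \<phi>)"
  proof (rule insert.IH)
    show "\<tau> \<^bold>\<longrightarrow> \<phi> \<in> v" if "valuation v" "T \<subseteq> v" for v
      using insert.prems(2)[of v] that by auto
  qed (use insert.prems in blast)
  then show ?case
    using insert.prems(1) ECNZ.MP by blast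
qed

section \<open>States of the canonical model\<close>

definition states :: "'p fm set set" where
  "states = {s. valuation s \<and> Collect ECNZ \<subseteq> s}"

lemma valuation_states: "s \<in> states \<Longrightarrow> valuation s"
  and ECNZ_states: "s \<in> states \<Longrightarrow> ECNZ \<phi> \<Longrightarrow> \<phi> \<in> s"
  by (auto simp: states_def)

text \<open>Compactness turns the absence of finite refutations into a state: if finitely many members of
  \<open>\<Gamma>\<close> and finitely many theorems had no common valuation, then the theorems alone would entail the
  negated conjunction of those members.\<close>

lemma states_extend:
  assumes "\<And>A \<chi>. finite A \<Longrightarrow> A \<subseteq> \<Gamma> \<Longrightarrow> (\<And>v. valuation v \<Longrightarrow> \<chi> \<in> v \<longleftrightarrow> \<not> A \<subseteq> v) \<Longrightarrow> \<not> ECNZ \<chi>"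
  shows "\<exists>s\<in>states. \<Gamma> \<subseteq> s"
proof -
  have "\<exists>v. valuation v \<and> B \<subseteq> v" if B: "B \<subseteq> \<Gamma> \<union> Collect ECNZ" "finite B" for B
  proof (rule ccontr)
    assume unsat: "\<nexists>v. valuation v \<and> B \<subseteq> v"
    obtain \<gamma>s where \<gamma>s: "set \<gamma>s = B \<inter> \<Gamma>"
      using finite_list B(2) by blast
    let ?\<chi> = "\<^bold>\<not> foldl Conj \<^bold>\<top> \<gamma>s"
    have "ECNZ ?\<chi>"
    proof (rule ECNZ_consequence)
      show "finite (B - \<Gamma>)" "\<And>\<tau>. \<tau> \<in> B - \<Gamma> \<Longrightarrow> ECNZ \<tau>"
        using B by auto
      show "?\<chi> \<in> v" if "valuation v" "B - \<Gamma> \<subseteq> v" for v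
      proof -
        have "\<not> B \<inter> \<Gamma> \<subseteq> v"
          using that unsat by blast
        then show ?thesis
          using that \<gamma>s by simp
      qed
    qed
    moreover have "\<not> ECNZ ?\<chi>"
      by (rule assms[of "B \<inter> \<Gamma>"]) (use B \<gamma>s in auto)
    ultimately show False
      by blast
  qed
  then have "finitely_satisfiable (\<Gamma> \<union> Collect ECNZ)"
    by (simp add: finitely_satisfiable_def)
  then obtain s where "valuation s" "\<Gamma> \<union> Collect ECNZ \<subseteq> s"
    by (rule propositional_compactness)
  then show ?thesis
    by (auto simp: states_def)
qed

text \<open>Consistency only speaks of nonempty lists of members of \<open>\<Gamma>\<close>. Given some \<open>\<gamma> \<in> \<Gamma>\<close>, a
  refutation from no members at all is also one from \<open>\<gamma>\<close>. For \<open>\<Gamma> = {}\<close> the conclusion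
  would be that the system itself is consistent.\<close>

lemma ECNZ_state_extension:
  assumes "consistent ECNZ \<Gamma>" "\<Gamma> \<noteq> {}"
  shows "\<exists>s\<in>states. \<Gamma> \<subseteq> s"
proof (rule states_extend)
  fix A \<chi>
  assume A: "finite A" "A \<subseteq> \<Gamma>" "\<And>v. valuation v \<Longrightarrow> \<chi> \<in> v \<longleftrightarrow> \<not> A \<subseteq> v"
  show "\<not> ECNZ \<chi>"
  proof
    assume "ECNZ \<chi>"
    obtain \<gamma>s where \<gamma>s: "set \<gamma>s = A"
      using finite_list A(1) by blast
    obtain \<gamma> where \<gamma>: "\<gamma> \<in> \<Gamma>"
      using assms(2) by blast
    have "ECNZ (\<^bold>\<not> foldl Conj \<gamma> \<gamma>s)"
      by (rule ECNZ_consequence[of "{\<chi>}"]) (use \<open>ECNZ \<chi>\<close> A \<gamma>s in auto)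
    moreover have "set (\<gamma> # \<gamma>s) \<subseteq> \<Gamma>"
      using \<gamma> \<gamma>s A(2) by simp
    ultimately show False
      using assms(1) unfolding consistent_def by blast
  qed
qed

lemma ECNZ_if_in_all_states:
  assumes "\<And>s. s \<in> states \<Longrightarrow> \<phi> \<in> s"
  shows "ECNZ \<phi>"
proof (rule ccontr)
  assume unprovable: "\<not> ECNZ \<phi>"
  have "\<exists>s\<in>states. {\<^bold>\<not> \<phi>} \<subseteq> s"
  proof (rule states_extend)
    fix A \<chi>
    assume A: "finite A" "A \<subseteq> {\<^bold>\<not> \<phi>}" "\<And>v. valuation v \<Longrightarrow> \<chi> \<in> v \<longleftrightarrow> \<not> A \<subseteq> v"
    show "\<not> ECNZ \<chi>"
    proof
      assume "ECNZ \<chi>"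
      have "ECNZ \<phi>"
        by (rule ECNZ_consequence[of "{\<chi>}"]) (use \<open>ECNZ \<chi>\<close> A in auto)
      then show False
        using unprovable by blast
    qed
  qed
  then show False
    using assms valuation_states by fastforce
qed

section \<open>The canonical model\<close>

definition proof_set :: "'p fm \<Rightarrow> 'p fm set set" where
  "proof_set \<phi> = {s \<in> states. \<phi> \<in> s}"

definition canonical_nbhd :: "'p fm set \<Rightarrow> 'p fm set set set" where
  "canonical_nbhd s = {proof_set \<phi> | \<phi>. \<Delta> \<phi> \<in> s}"

lemma proof_set_Neg: "proof_set (\<^bold>\<not> \<phi>) = states - proof_set \<phi>"
  and proof_set_Conj: "proof_set (\<phi> \<^bold>\<and> \<psi>) = proof_set \<phi> \<inter> proof_set \<psi>"
  and proof_set_Top: "proof_set \<^bold>\<top> = states"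
  by (auto simp: proof_set_def valuation_states)

lemma Delta_Neg_states:
  assumes "s \<in> states"
  shows "\<Delta> (\<^bold>\<not> \<phi>) \<in> s \<longleftrightarrow> \<Delta> \<phi> \<in> s"
  using ECNZ_states[OF assms ECNZ.Equ[of \<phi>]] valuation_states[OF assms] by auto

lemma Delta_Conj_states:
  assumes "s \<in> states" "\<Delta> \<phi> \<in> s" "\<Delta> \<psi> \<in> s"
  shows "\<Delta> (\<phi> \<^bold>\<and> \<psi>) \<in> s"
  using ECNZ_states[OF assms(1) ECNZ.C[of \<phi> \<psi>]] valuation_states[OF assms(1)] assms(2,3) by auto

text \<open>A neighborhood may be the proof set of many formulas. It does not matter which of them is
  chosen, because formulas with the same proof set are provably equivalent, and \<open>RE\<Delta>\<close> transfers the
  equivalence to \<open>\<Delta>\<close>.\<close>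

lemma Delta_iff_proof_set:
  assumes "s \<in> states"
  shows "proof_set \<phi> \<in> canonical_nbhd s \<longleftrightarrow> \<Delta> \<phi> \<in> s"
proof
  assume "proof_set \<phi> \<in> canonical_nbhd s"
  then obtain \<psi> where \<psi>: "proof_set \<phi> = proof_set \<psi>" "\<Delta> \<psi> \<in> s"
    by (auto simp: canonical_nbhd_def)
  have "ECNZ (\<phi> \<^bold>\<longleftrightarrow> \<psi>)"
  proof (rule ECNZ_if_in_all_states)
    fix t :: "'a fm set" assume "t \<in> states"
    then have "\<phi> \<in> t \<longleftrightarrow> \<psi> \<in> t"
      using \<psi>(1) by (auto simp: proof_set_def)
    then show "(\<phi> \<^bold>\<longleftrightarrow> \<psi>) \<in> t"
      using valuation_states[OF \<open>t \<in> states\<close>] by simp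
  qed
  then have "(\<Delta> \<phi> \<^bold>\<longleftrightarrow> \<Delta> \<psi>) \<in> s"
    using ECNZ.RE ECNZ_states[OF assms] by blast
  then show "\<Delta> \<phi> \<in> s"
    using \<psi>(2) valuation_states[OF assms] by simp
qed (auto simp: canonical_nbhd_def)

lemma truth_lemma:
  "s \<in> states \<Longrightarrow>
    sat (states, canonical_nbhd) (\<lambda>p. proof_set (Atom p)) s \<phi> \<longleftrightarrow> \<phi> \<in> s"
proof (induction \<phi> arbitrary: s)
  case (Delta \<phi>)
  have "{t \<in> states. sat (states, canonical_nbhd) (\<lambda>p. proof_set (Atom p)) t \<phi>} = proof_set \<phi>"
    using Delta.IH by (auto simp: proof_set_def)
  then have "sat (states, canonical_nbhd) (\<lambda>p. proof_set (Atom p)) s (\<Delta> \<phi>) \<longleftrightarrow>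
      proof_set \<phi> \<in> canonical_nbhd s \<or> proof_set (\<^bold>\<not> \<phi>) \<in> canonical_nbhd s"
    by (simp add: proof_set_Neg)
  then show ?case
    by (simp add: Delta_iff_proof_set Delta_Neg_states Delta.prems)
qed (auto simp: proof_set_def valuation_states)

lemma canonical_frame_cnz:
  assumes "states \<noteq> ({} :: 'p fm set set)"
  shows "(states :: 'p fm set set, canonical_nbhd) \<in> cnz_frames"
proof -
  let ?F = "(states :: 'p fm set set, canonical_nbhd)"
  have "nbhd_frame ?F"
    using assms by (auto simp: nbhd_frame_def canonical_nbhd_def proof_set_def)
  moreover have "prop_c ?F"
  proof -
    have "X \<inter> Y \<in> canonical_nbhd s"
      if s: "s \<in> states" and XY: "X \<in> canonical_nbhd s" "Y \<in> canonical_nbhd s"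
      for s :: "'p fm set" and X Y
    proof -
      obtain \<phi> \<psi> where "X = proof_set \<phi>" "\<Delta> \<phi> \<in> s" "Y = proof_set \<psi>" "\<Delta> \<psi> \<in> s"
        using XY by (auto simp: canonical_nbhd_def)
      then show ?thesis
        using Delta_iff_proof_set[of s "\<phi> \<^bold>\<and> \<psi>"] Delta_Conj_states s
        by (simp add: proof_set_Conj)
    qed
    then show ?thesis
      by (auto simp: prop_c_def)
  qed
  moreover have "prop_n ?F"
    using Delta_iff_proof_set[of _ "\<^bold>\<top> :: 'p fm"] ECNZ_states[OF _ ECNZ.N, where ?'a = 'p]
    by (simp add: prop_n_def proof_set_Top)
  moreover have "prop_z ?F"
  proof -
    have "states - X \<in> canonical_nbhd s"
      if s: "s \<in> states" and X: "X \<in> canonical_nbhd s" for s :: "'p fm set" and X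
    proof -
      obtain \<phi> where "X = proof_set \<phi>" "\<Delta> \<phi> \<in> s"
        using X by (auto simp: canonical_nbhd_def)
      then show ?thesis
        using Delta_iff_proof_set[of s "\<^bold>\<not> \<phi>"] Delta_Neg_states[OF s, of \<phi>] s
        by (simp add: proof_set_Neg)
    qed
    then show ?thesis
      by (auto simp: prop_z_def)
  qed
  ultimately show ?thesis
    by (simp add: cnz_frames_def)
qed

theorem theorem9:
  "strongly_complete (ECNZ :: 'p fm \<Rightarrow> bool) (cnz_frames :: 'p fm set frame set)"
  unfolding strongly_complete_def
proof (intro allI impI)
  fix \<Gamma> :: "'p fm set"
  assume "consistent ECNZ \<Gamma>"
  show "\<exists>F\<in>(cnz_frames :: 'p fm set frame set).
    \<exists>V. nbhd_model F V \<and> (\<exists>s\<in>fst F. \<forall>\<phi>\<in>\<Gamma>. sat F V s \<phi>)"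
  proof (cases "\<Gamma> = {}")
    case True
    \<comment> \<open>Any model will do, here one with the single state \<open>{}\<close> and all sets as neighborhoods.\<close>
    let ?F = "({{}}, \<lambda>_. Pow {{}}) :: 'p fm set frame"
    have "?F \<in> cnz_frames"
      by (auto simp: cnz_frames_def nbhd_frame_def prop_c_def prop_n_def prop_z_def)
    moreover have "nbhd_model ?F (\<lambda>_. {})"
      by (simp add: nbhd_model_def nbhd_frame_def)
    ultimately show ?thesis
      using True by fastforce
  next
    case False
    let ?F = "(states, canonical_nbhd) :: 'p fm set frame"
    obtain s where s: "s \<in> states" "\<Gamma> \<subseteq> s"
      using ECNZ_state_extension[OF \<open>consistent ECNZ \<Gamma>\<close> False] by blast
    have F: "?F \<in> cnz_frames"
      using s(1) by (intro canonical_frame_cnz) blast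
    moreover have "nbhd_model ?F (\<lambda>p. proof_set (Atom p))"
      using F by (auto simp: nbhd_model_def cnz_frames_def proof_set_def)
    moreover have "\<forall>\<phi>\<in>\<Gamma>. sat ?F (\<lambda>p. proof_set (Atom p)) s \<phi>"
      using s truth_lemma by blast
    ultimately show ?thesis
      using s(1) by (metis fst_conv)
  qed
qed

end
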